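(* Let $\Omega$ be a finite set, let $k,l \geq 2$ be multiplicatively independent integers, and let $f \colon \mathbb{N}_0 \to \Omega$ be a sequence. Suppose that $f$ is $k$-automatic and asymptotically $l$-automatic. Then $f$ is asymptotically equal to a periodic sequence, i.e. there exists a periodic sequence $\tilde f\colon\mathbb{N}_0\to\Omega$ with $f(n)=\tilde f(n)$ for almost all $n\in\mathbb{N}_0$.
   Context: $\mathbb{N}_0 = \{0,1,2,\dots\}$. Integers $k,l\geq 2$ are multiplicatively independent if $\log k/\log l \notin \mathbb{Q}$. For $A \subset \mathbb{N}_0$, the upper density is $\bar d(A) = \limsup_{N\to\infty} |A\cap\{0,\dots,N-1\}|/N$; a property holds for almost all $n\in\mathbb{N}_0$ if the set of $n$ where it fails has upper density $0$. Two sequences $f,g\colon \mathbb{N}_0\to\Omega$ are asymptotically equal, written $f\simeq g$, if $f(n)=g(n)$ for almost all $n$. The $k$-kernel of $f$ is $\mathcal{N}_k(f) = \{ n \mapsto f(k^\alpha n + r) : \alpha, r \in \mathbb{N}_0,\ r < k^\alpha\}$. The sequence $f$ is $k$-automatic if $\mathcal{N}_k(f)$ is finite, and asymptotically $l$-automatic if the set of equivalence classes $\mathcal{N}_l(f)/{\simeq}$ is finite. *)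

theory Defs
  imports "HOL-Analysis.Analysis"
begin

definition mult_indep :: "nat \<Rightarrow> nat \<Rightarrow> bool" where
  "mult_indep k l \<longleftrightarrow> ln (real k) / ln (real l) \<notin> \<rat>"

definition upper_density :: "nat set \<Rightarrow> ereal" where
  "upper_density A = limsup (\<lambda>N. ereal (real (card (A \<inter> {..<N})) / real N))"

definition asym_eq :: "(nat \<Rightarrow> 'a) \<Rightarrow> (nat \<Rightarrow> 'a) \<Rightarrow> bool" where
  "asym_eq f g \<longleftrightarrow> upper_density {n. f n \<noteq> g n} = 0"

definition kernel :: "nat \<Rightarrow> (nat \<Rightarrow> 'a) \<Rightarrow> (nat \<Rightarrow> 'a) set" where
  "kernel k f = {(\<lambda>n. f (k ^ a * n + r)) | a r. r < k ^ a}"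

definition automatic :: "nat \<Rightarrow> (nat \<Rightarrow> 'a) \<Rightarrow> bool" where
  "automatic k f \<longleftrightarrow> finite (kernel k f)"

definition asym_automatic :: "nat \<Rightarrow> (nat \<Rightarrow> 'a) \<Rightarrow> bool" where
  "asym_automatic l f \<longleftrightarrow>
     finite ((\<lambda>g. {h \<in> kernel l f. asym_eq g h}) ` kernel l f)"

definition periodic :: "(nat \<Rightarrow> 'a) \<Rightarrow> bool" where
  "periodic g \<longleftrightarrow> (\<exists>p>0. \<forall>n. g (n + p) = g n)"

end

theory Submission
  imports Defs
begin

text \<open>
  Finiteness of the kernels means that, for some map \<open>q\<close> with finite range, indices \<open>n\<close> and \<open>m\<close>
  with \<open>q n = q m\<close> head identical blocks of \<open>f\<close> of length \<open>k ^ \<alpha>\<close>, for every \<open>\<alpha>\<close>; in base \<open>l\<close> the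
  same holds off a set of density zero. Choose \<open>k ^ \<alpha>\<close> and \<open>l ^ \<beta>\<close> distinct but with ratio
  close to 1. A pair of adjacent \<open>k\<close>-states of positive upper density recurs, together with the
  \<open>l\<close>-states at the same place, at two indices of bounded distance; subtracting the two resulting
  translations shows that \<open>f\<close> has a small local period on all blocks with these states. Overlapping
  local periods merge, so \<open>f (y + T) = f y\<close> for almost all \<open>y\<close> and some fixed \<open>T\<close>.

  It remains to see that the slowly varying sequence \<open>g n = f (T * n + c)\<close> is almost everywhere
  constant. It is constant on every block headed by an index \<open>n\<close> whose state has positive upper density,
  and by pigeonhole its value there does not change under multiplication by some power of \<open>k\<close>,
  while \<open>g\<close> is almost everywhere unchanged under multiplication by some power of \<open>l\<close>. The products of
  these powers being dense on the logarithmic scale, any two such blocks can be scaled to overlap, so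
  they carry the same value.
\<close>

section \<open>Sets of density zero\<close>

text \<open>Upper density zero with the denominator multiplied out: counting estimates stay in the
  reals, without \<open>limsup\<close>, \<open>ereal\<close> or the quotient at
  \<open>N = 0\<close>.\<close>

definition zero_density :: "nat set \<Rightarrow> bool" where
  "zero_density D \<longleftrightarrow>
     (\<forall>e>0. \<forall>\<^sub>F N in sequentially. real (card (D \<inter> {..<N})) \<le> e * real N)"

lemma zero_density_iff: "zero_density D \<longleftrightarrow> upper_density D = 0"
proof
  assume D: "zero_density D"
  have "limsup (\<lambda>N. ereal (real (card (D \<inter> {..<N})) / real N)) \<le> 0"
    unfolding Limsup_le_iff
  proof (intro allI impI)
    fix y :: ereal assume "0 < y"
    then obtain e where e: "0 < ereal e" "ereal e < y"
      using ereal_dense2 by blast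
    then have "\<forall>\<^sub>F N in sequentially. real (card (D \<inter> {..<N})) \<le> e * real N"
      using D by (auto simp: zero_density_def)
    then show "\<forall>\<^sub>F N in sequentially. ereal (real (card (D \<inter> {..<N})) / real N) < y"
      using eventually_gt_at_top[of 0]
    proof eventually_elim
      case (elim N)
      then have "ereal (real (card (D \<inter> {..<N})) / real N) \<le> ereal e"
        by (simp add: field_simps)
      with e show ?case by (meson le_less_trans)
    qed
  qed
  moreover have "0 \<le> limsup (\<lambda>N. ereal (real (card (D \<inter> {..<N})) / real N))"
    by (rule le_Limsup) auto
  ultimately show "upper_density D = 0"
    unfolding upper_density_def by (rule antisym)
next
  assume D: "upper_density D = 0"
  show "zero_density D"
    unfolding zero_density_def
  proof (intro allI impI)
    fix e :: real assume "0 < e"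
    then have "limsup (\<lambda>N. ereal (real (card (D \<inter> {..<N})) / real N)) < ereal e"
      using D by (simp add: upper_density_def)
    then have "\<forall>\<^sub>F N in sequentially. ereal (real (card (D \<inter> {..<N})) / real N) < ereal e"
      by (rule Limsup_lessD)
    then show "\<forall>\<^sub>F N in sequentially. real (card (D \<inter> {..<N})) \<le> e * real N"
      using eventually_gt_at_top[of 0]
      by eventually_elim (simp add: field_simps)
  qed
qed

lemma zero_densityD:
  "zero_density D \<Longrightarrow> 0 < e \<Longrightarrow>
     \<forall>\<^sub>F N in sequentially. real (card (D \<inter> {..<N})) \<le> e * real N"
  by (simp add: zero_density_def)

lemma zero_density_subset:
  assumes "zero_density D" "C \<subseteq> D"
  shows "zero_density C"
  unfolding zero_density_def
proof (intro allI impI)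
  fix e :: real assume "0 < e"
  then have "\<forall>\<^sub>F N in sequentially. real (card (D \<inter> {..<N})) \<le> e * real N"
    using assms(1) by (auto simp: zero_density_def)
  then show "\<forall>\<^sub>F N in sequentially. real (card (C \<inter> {..<N})) \<le> e * real N"
  proof eventually_elim
    case (elim N)
    have "card (C \<inter> {..<N}) \<le> card (D \<inter> {..<N})"
      using assms(2) by (intro card_mono) auto
    with elim show ?case by linarith
  qed
qed

lemma zero_density_finite:
  assumes "finite D"
  shows "zero_density D"
  unfolding zero_density_def
proof (intro allI impI)
  fix e :: real assume "0 < e"
  have "\<forall>\<^sub>F N in sequentially. real (card D) / e \<le> real N"
    using filterlim_real_sequentially unfolding filterlim_at_top by blast
  then show "\<forall>\<^sub>F N in sequentially. real (card (D \<inter> {..<N})) \<le> e * real N"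
  proof eventually_elim
    case (elim N)
    have "card (D \<inter> {..<N}) \<le> card D"
      using assms by (intro card_mono) auto
    with elim \<open>0 < e\<close> show ?case by (simp add: field_simps)
  qed
qed

lemma zero_density_Un:
  assumes "zero_density C" "zero_density D"
  shows "zero_density (C \<union> D)"
  unfolding zero_density_def
proof (intro allI impI)
  fix e :: real assume "0 < e"
  then have "\<forall>\<^sub>F N in sequentially. real (card (C \<inter> {..<N})) \<le> (e/2) * real N"
    "\<forall>\<^sub>F N in sequentially. real (card (D \<inter> {..<N})) \<le> (e/2) * real N"
    using assms by (intro zero_densityD; simp)+
  then show "\<forall>\<^sub>F N in sequentially. real (card ((C \<union> D) \<inter> {..<N})) \<le> e * real N"
  proof eventually_elim
    case (elim N)
    have "card ((C \<union> D) \<inter> {..<N}) \<le> card (C \<inter> {..<N}) + card (D \<inter> {..<N})"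
      by (simp add: Int_Un_distrib2 card_Un_le)
    with elim show ?case by (simp add: field_simps)
  qed
qed

lemma zero_density_UN:
  assumes "finite I" "\<And>i. i \<in> I \<Longrightarrow> zero_density (D i)"
  shows "zero_density (\<Union>i\<in>I. D i)"
  using assms by (induction I) (auto intro: zero_density_Un zero_density_finite)

text \<open>The map sends \<open>{..<N}\<close> injectively into \<open>{..<C * N}\<close>, so the
  count below \<open>N\<close> is at most that of \<open>D\<close> below \<open>C * N\<close>; the
  factor \<open>C\<close> is absorbed by taking \<open>e / C\<close>.\<close>

lemma zero_density_vimage:
  assumes D: "zero_density D" and inj: "inj \<phi>" and bound: "\<And>n. \<phi> n < C * Suc n"
  shows "zero_density {n. \<phi> n \<in> D}"
  unfolding zero_density_def
proof (intro allI impI)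
  fix e :: real assume e: "0 < e"
  have C: "0 < C" using bound[of 0] by simp
  obtain N0 where N0: "\<And>N. N \<ge> N0 \<Longrightarrow> real (card (D \<inter> {..<N})) \<le> (e / C) * real N"
    using zero_densityD[OF D, of "e / C"] e C by (auto simp: eventually_sequentially)
  have "real (card ({n. \<phi> n \<in> D} \<inter> {..<N})) \<le> e * real N" if N: "N \<ge> N0" for N
  proof -
    have "card ({n. \<phi> n \<in> D} \<inter> {..<N}) \<le> card (D \<inter> {..<C * N})"
    proof (rule card_inj_on_le[of \<phi>])
      show "\<phi> ` ({n. \<phi> n \<in> D} \<inter> {..<N}) \<subseteq> D \<inter> {..<C * N}"
      proof safe
        fix n assume "n < N"
        then have "C * Suc n \<le> C * N" by (intro mult_le_mono) auto
        with bound[of n] show "\<phi> n < C * N" by linarith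
      qed
    qed (use inj in \<open>auto intro: inj_on_subset\<close>)
    moreover have "N0 \<le> C * N" using N C by (metis le_trans mult_le_mono1 Suc_leI One_nat_def mult_1)
    ultimately show ?thesis using N0[of "C * N"] C by (simp add: field_simps)
  qed
  then show "\<forall>\<^sub>F N in sequentially. real (card ({n. \<phi> n \<in> D} \<inter> {..<N})) \<le> e * real N"
    by (auto simp: eventually_sequentially)
qed

lemma zero_density_vimage_affine:
  assumes "zero_density D" "0 < c"
  shows "zero_density {n. c * n + d \<in> D}"
proof (rule zero_density_vimage[OF assms(1), where C = "c + d + 1"])
  show "inj (\<lambda>n. c * n + d)" using assms(2) by (auto simp: inj_def)
  show "c * n + d < (c + d + 1) * Suc n" for n
    by (simp add: algebra_simps)
qed

text \<open>Turns an exceptional set of block indices into one of points: each index accounts for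
  only \<open>c\<close> points.\<close>

lemma zero_density_div:
  assumes D: "zero_density D" and c: "0 < c"
  shows "zero_density {x. x div c \<in> D}"
  unfolding zero_density_def
proof (intro allI impI)
  fix e :: real assume e: "0 < e"
  then have "\<forall>\<^sub>F N in sequentially. real (card (D \<inter> {..<N})) \<le> (e / c) * real N"
    using D c unfolding zero_density_def by (meson divide_pos_pos of_nat_0_less_iff)
  then show "\<forall>\<^sub>F N in sequentially. real (card ({x. x div c \<in> D} \<inter> {..<N})) \<le> e * real N"
  proof eventually_elim
    case (elim N)
    have "card ({x. x div c \<in> D} \<inter> {..<N}) \<le> card ((D \<inter> {..<N}) \<times> {..<c})"
    proof (rule card_inj_on_le[of "\<lambda>x. (x div c, x mod c)"])
      show "inj_on (\<lambda>x. (x div c, x mod c)) ({x. x div c \<in> D} \<inter> {..<N})"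
        by (rule inj_onI) (metis prod.inject mult_div_mod_eq)
      show "(\<lambda>x. (x div c, x mod c)) ` ({x. x div c \<in> D} \<inter> {..<N}) \<subseteq> (D \<inter> {..<N}) \<times> {..<c}"
        using c by (auto intro: le_less_trans[OF div_le_dividend])
    qed auto
    then have "real (card ({x. x div c \<in> D} \<inter> {..<N})) \<le> real (card (D \<inter> {..<N})) * real c"
      by (simp add: card_cartesian_product flip: of_nat_mult)
    also have "\<dots> \<le> e / c * real N * real c"
      using elim by (intro mult_right_mono) auto
    finally show ?case using c by simp
  qed
qed

text \<open>The bound \<open>K\<close> is fixed while \<open>H\<close> is arbitrarily large. Tiling
  by windows of length \<open>H\<close>, those starting outside \<open>D\<close> contribute density
  at most \<open>K / H\<close>, the others density zero.\<close>

lemma zero_density_if_sparse_in_windows: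
  assumes sparse: "\<And>H0. \<exists>H\<ge>H0. \<exists>D. zero_density D \<and> (\<forall>n. n \<notin> D \<longrightarrow> card (A \<inter> {n..<n + H}) \<le> K)"
  shows "zero_density A"
  unfolding zero_density_def
proof (intro allI impI)
  fix e :: real assume e: "0 < e"
  \<comment> \<open>Budget: \<open>e / 2\<close> for the bad windows, \<open>e / 4\<close> for the
    full good ones, and \<open>e / 4\<close> for the one incomplete window once \<open>N\<close> is
    large.\<close>
  obtain H0 :: nat where H0: "4 * K / e < real H0" using reals_Archimedean2 by blast
  obtain H D where H: "H \<ge> Suc H0" and D: "zero_density D"
    and card: "\<And>n. n \<notin> D \<Longrightarrow> card (A \<inter> {n..<n + H}) \<le> K"
    using sparse[of "Suc H0"] by blast
  have Hpos: "0 < H" using H by simp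
  have KH: "K / H \<le> e / 4"
  proof -
    have "4 * K / e < real H" using H0 H by linarith
    then show ?thesis using e Hpos by (simp add: field_simps)
  qed
  define D2 where "D2 = {m. H * m + 0 \<in> D}"
  have "zero_density {x. x div H \<in> D2}"
    unfolding D2_def using D Hpos by (intro zero_density_div zero_density_vimage_affine)
  then have "\<forall>\<^sub>F N in sequentially. real (card ({x. x div H \<in> D2} \<inter> {..<N})) \<le> (e / 2) * real N"
    using e by (intro zero_densityD) auto
  moreover have "\<forall>\<^sub>F N in sequentially. 4 * K / e \<le> real N"
    using filterlim_real_sequentially unfolding filterlim_at_top by blast
  ultimately show "\<forall>\<^sub>F N in sequentially. real (card (A \<inter> {..<N})) \<le> e * real N"
  proof eventually_elim
    case (elim N)
    let ?B = "\<lambda>m. A \<inter> {H * m..<H * m + H}"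
    have "A \<inter> {..<N} \<subseteq> ({x. x div H \<in> D2} \<inter> {..<N}) \<union> (\<Union>m\<in>{..N div H} - D2. ?B m)"
    proof
      fix x assume x: "x \<in> A \<inter> {..<N}"
      show "x \<in> ({x. x div H \<in> D2} \<inter> {..<N}) \<union> (\<Union>m\<in>{..N div H} - D2. ?B m)"
      proof (cases "x div H \<in> D2")
        case False
        have "x div H \<le> N div H" using x by (intro div_le_mono) auto
        moreover have "H * (x div H) \<le> x" by simp
        moreover have "x < H * (x div H) + H"
          using Hpos dividend_less_times_div[of H x] by (simp add: algebra_simps)
        ultimately have "x \<in> ?B (x div H)" "x div H \<in> {..N div H} - D2" using x False by auto
        then show ?thesis by blast
      qed (use x in auto)
    qed
    then have "card (A \<inter> {..<N}) \<le>
        card (({x. x div H \<in> D2} \<inter> {..<N}) \<union> (\<Union>m\<in>{..N div H} - D2. ?B m))"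
      by (intro card_mono) auto
    also have "\<dots> \<le> card ({x. x div H \<in> D2} \<inter> {..<N}) + card (\<Union>m\<in>{..N div H} - D2. ?B m)"
      by (rule card_Un_le)
    also have "card (\<Union>m\<in>{..N div H} - D2. ?B m) \<le> (\<Sum>m\<in>{..N div H} - D2. card (?B m))"
      by (rule card_UN_le) auto
    also have "\<dots> \<le> (\<Sum>m\<in>{..N div H} - D2. K)"
      by (rule sum_mono) (auto simp: D2_def intro: card)
    also have "\<dots> \<le> (N div H + 1) * K"
    proof -
      have "card ({..N div H} - D2) \<le> card {..N div H}" by (intro card_mono) auto
      then have "card ({..N div H} - D2) * K \<le> (N div H + 1) * K" by (intro mult_le_mono1) simp
      then show ?thesis by simp
    qed
    finally have "real (card (A \<inter> {..<N})) \<le>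
        real (card ({x. x div H \<in> D2} \<inter> {..<N}) + (N div H + 1) * K)"
      by (intro of_nat_mono) simp
    then have *: "real (card (A \<inter> {..<N})) \<le>
        real (card ({x. x div H \<in> D2} \<inter> {..<N})) + (real (N div H) + 1) * K"
      by (simp add: algebra_simps)
    have "real (N div H) \<le> real N / real H" by (rule of_nat_div_le_of_nat)
    then have "(real (N div H) + 1) * K \<le> (real N / real H + 1) * K"
      by (intro mult_right_mono) auto
    also have "\<dots> = (K / H) * N + K" by (simp add: field_simps)
    also have "\<dots> \<le> (e / 4) * N + (e / 4) * N"
      using elim(2) e KH by (intro add_mono mult_right_mono) (auto simp: field_simps)
    finally show ?case using * elim(1) by (simp add: field_simps)
  qed
qed

text \<open>The same \<open>H\<close> serves every \<open>D\<close>, so the exceptional set may be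
  chosen after \<open>H\<close>. The form "eventually in \<open>H\<close>" lets finitely many sets
  share one \<open>H\<close>.\<close>

lemma eventually_dense_window:
  assumes "\<not> zero_density A"
  shows "\<forall>\<^sub>F H in sequentially. \<forall>D. zero_density D \<longrightarrow>
           (\<exists>n. n \<notin> D \<and> K < card (A \<inter> {n..<n + H}))"
proof (rule ccontr)
  assume "\<not> ?thesis"
  then have "\<exists>H\<ge>H0. \<exists>D. zero_density D \<and> (\<forall>n. n \<notin> D \<longrightarrow> card (A \<inter> {n..<n + H}) \<le> K)" for H0
    unfolding eventually_sequentially by (meson not_less)
  then have "zero_density A" by (rule zero_density_if_sparse_in_windows)
  with assms show False ..
qed

text \<open>Such an interval fills a share tending to \<open>1 / Suc u\<close> of the numbers below
  its right end, which exceeds the share \<open>1 / (2 * Suc u)\<close> allowed for large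
  \<open>X\<close>.\<close>

lemma zero_density_not_long_intervals:
  assumes D: "zero_density D" and unb: "\<And>X0. \<exists>X\<ge>X0. {X * u + c..<X * Suc u} \<subseteq> D"
  shows False
proof -
  obtain N0 where N0: "\<And>N. N \<ge> N0 \<Longrightarrow> real (card (D \<inter> {..<N})) \<le> (1 / (2 * Suc u)) * real N"
    using zero_densityD[OF D, of "1 / (2 * Suc u)"] unfolding eventually_sequentially by auto
  obtain X where X: "X \<ge> N0 + 2 * c + 1" "{X * u + c..<X * Suc u} \<subseteq> D"
    using unb by blast
  have "{X * u + c..<X * Suc u} \<subseteq> D \<inter> {..<X * Suc u}" using X(2) by auto
  then have "card {X * u + c..<X * Suc u} \<le> card (D \<inter> {..<X * Suc u})"
    by (intro card_mono) auto
  then have "X - c \<le> card (D \<inter> {..<X * Suc u})" by simp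
  then have "real X - real c \<le> real (card (D \<inter> {..<X * Suc u}))" by linarith
  also have "\<dots> \<le> (1 / (2 * Suc u)) * real (X * Suc u)"
    using X(1) by (intro N0) simp
  also have "\<dots> = real X / 2" by (simp add: field_simps)
  finally show False using X(1) by simp
qed

lemma zero_density_infrequent_values:
  assumes "finite (range q)"
  shows "zero_density {n. zero_density {m. q m = q n}}"
proof -
  have "zero_density (\<Union>s\<in>{s \<in> range q. zero_density {m. q m = s}}. {m. q m = s})"
    using assms by (intro zero_density_UN) auto
  then show ?thesis by (rule zero_density_subset) auto
qed

section \<open>State maps\<close>

definition blocks_agree :: "nat \<Rightarrow> (nat \<Rightarrow> 'a) \<Rightarrow> (nat \<Rightarrow> 's) \<Rightarrow> nat set \<Rightarrow> bool" where
  "blocks_agree c f q D \<longleftrightarrow>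
     (\<forall>n m r. n \<notin> D \<longrightarrow> m \<notin> D \<longrightarrow> q n = q m \<longrightarrow> r < c \<longrightarrow> f (c * n + r) = f (c * m + r))"

definition state_map :: "nat \<Rightarrow> (nat \<Rightarrow> 'a) \<Rightarrow> (nat \<Rightarrow> 's) \<Rightarrow> bool" where
  "state_map k f q \<longleftrightarrow> finite (range q) \<and> (\<forall>a. blocks_agree (k ^ a) f q {})"

text \<open>The exceptional set may vary with the scale \<open>b\<close>, but one finite set of
  states serves all scales; pigeonhole arguments across scales rest on this.\<close>

definition asym_state_map :: "nat \<Rightarrow> (nat \<Rightarrow> 'a) \<Rightarrow> (nat \<Rightarrow> 's) \<Rightarrow> bool" where
  "asym_state_map l f q \<longleftrightarrow>
     finite (range q) \<and> (\<forall>b. \<exists>D. zero_density D \<and> blocks_agree (l ^ b) f q D)"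

lemma blocks_agreeD:
  "blocks_agree c f q D \<Longrightarrow> n \<notin> D \<Longrightarrow> m \<notin> D \<Longrightarrow> q n = q m \<Longrightarrow> r < c \<Longrightarrow>
     f (c * n + r) = f (c * m + r)"
  unfolding blocks_agree_def by blast

lemma blocks_agree_run:
  assumes agree: "blocks_agree c f q D"
    and run: "\<And>t. t < T \<Longrightarrow> n + t \<notin> D \<and> m + t \<notin> D \<and> q (n + t) = q (m + t)"
    and y: "y < c * T"
  shows "f (c * n + y) = f (c * m + y)"
proof -
  have c: "0 < c" using y by (cases c) auto
  have "y div c < T" using y by (simp add: less_mult_imp_div_less mult.commute)
  then have "f (c * (n + y div c) + y mod c) = f (c * (m + y div c) + y mod c)"
    using run c by (intro blocks_agreeD[OF agree]) auto
  then show ?thesis by (simp add: algebra_simps)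
qed

text \<open>The state of \<open>n\<close> is the tuple of the values at \<open>n\<close> of all
  kernel sequences. There are finitely many tuples, as the kernel and the alphabet are
  finite.\<close>

lemma state_map_exists:
  fixes f :: "nat \<Rightarrow> 'a::finite"
  assumes "automatic k f"
  shows "\<exists>q :: nat \<Rightarrow> (nat \<Rightarrow> 'a) \<Rightarrow> 'a. state_map k f q"
proof -
  define q where "q = (\<lambda>n. restrict (\<lambda>h. h n) (kernel k f))"
  have "range q \<subseteq> PiE (kernel k f) (\<lambda>_. UNIV)" by (auto simp: q_def)
  moreover have "finite (PiE (kernel k f) (\<lambda>_. UNIV :: 'a set))"
    using assms by (intro finite_PiE) (auto simp: automatic_def)
  ultimately have "finite (range q)" by (rule finite_subset)
  moreover have "blocks_agree (k ^ a) f q {}" for a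
    unfolding blocks_agree_def
  proof (intro allI impI)
    fix n m r assume q: "q n = q m" and r: "r < k ^ a"
    have "(\<lambda>n. f (k ^ a * n + r)) \<in> kernel k f" using r by (auto simp: kernel_def)
    then show "f (k ^ a * n + r) = f (k ^ a * m + r)"
      using fun_cong[OF q, of "\<lambda>n. f (k ^ a * n + r)"] by (simp add: q_def)
  qed
  ultimately show ?thesis by (auto simp: state_map_def)
qed

text \<open>Here the tuple runs over representatives of the asymptotic classes. The exceptional set
  at level \<open>b\<close> collects the places where some kernel sequence of that level differs
  from its representative.\<close>

lemma asym_state_map_exists:
  fixes f :: "nat \<Rightarrow> 'a::finite"
  assumes "asym_automatic l f"
  shows "\<exists>q :: nat \<Rightarrow> (nat \<Rightarrow> 'a) \<Rightarrow> 'a. asym_state_map l f q"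
proof -
  let ?cls = "\<lambda>g. {h \<in> kernel l f. asym_eq g h}"
  obtain R where R': "R \<subseteq> kernel l f \<and> finite R \<and> ?cls ` kernel l f = ?cls ` R"
    by (rule exE[OF finite_subset_image[OF assms[unfolded asym_automatic_def] subset_refl]])
  note R = R'[THEN conjunct1] R'[THEN conjunct2, THEN conjunct1] R'[THEN conjunct2, THEN conjunct2]
  have rep: "\<exists>g\<in>R. asym_eq g h" if h: "h \<in> kernel l f" for h
  proof -
    obtain g where g: "g \<in> R" "?cls h = ?cls g"
      using imageI[OF h, of ?cls] unfolding R(3) by (elim imageE)
    \<comment> \<open>By reflexivity \<open>h\<close> lies in its own class, hence in that of
      \<open>g\<close>.\<close>
    have "asym_eq h h" using zero_density_finite[of "{}"] by (simp add: asym_eq_def zero_density_iff)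
    then have "h \<in> ?cls g" using that g(2) by blast
    then show ?thesis using g(1) by blast
  qed
  define q where "q = (\<lambda>n. restrict (\<lambda>h. h n) R)"
  have "range q \<subseteq> PiE R (\<lambda>_. UNIV)" by (auto simp: q_def)
  moreover have "finite (PiE R (\<lambda>_. UNIV :: 'a set))"
    using R(2) by (intro finite_PiE) auto
  ultimately have fin: "finite (range q)" by (rule finite_subset)
  have "\<exists>D. zero_density D \<and> blocks_agree (l ^ b) f q D" for b
  proof -
    have "\<forall>r\<in>{..<l ^ b}. \<exists>g\<in>R. asym_eq g (\<lambda>n. f (l ^ b * n + r))"
      by (intro ballI rep) (auto simp: kernel_def)
    then obtain G where G: "\<And>r. r < l ^ b \<Longrightarrow> G r \<in> R \<and> asym_eq (G r) (\<lambda>n. f (l ^ b * n + r))"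
      by (metis lessThan_iff)
    define D where "D = (\<Union>r<l ^ b. {n. G r n \<noteq> f (l ^ b * n + r)})"
    have "zero_density D"
      unfolding D_def using G by (intro zero_density_UN) (auto simp: asym_eq_def zero_density_iff)
    moreover have "blocks_agree (l ^ b) f q D"
      unfolding blocks_agree_def
    proof (intro allI impI)
      fix n m r assume *: "n \<notin> D" "m \<notin> D" "q n = q m" "r < l ^ b"
      have "G r n = G r m"
        using fun_cong[OF *(3), of "G r"] G[OF *(4)] by (simp add: q_def)
      then show "f (l ^ b * n + r) = f (l ^ b * m + r)" using * by (auto simp: D_def)
    qed
    ultimately show ?thesis by blast
  qed
  with fin show ?thesis by (auto simp: asym_state_map_def)
qed

lemma finite_range_map_window:
  assumes "finite (range q)"
  shows "finite (range (\<lambda>n :: nat. map (\<lambda>t. q (T * n + t)) [0..<T]))"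
proof (rule finite_subset)
  show "range (\<lambda>n. map (\<lambda>t. q (T * n + t)) [0..<T]) \<subseteq> {xs. set xs \<subseteq> range q \<and> length xs = T}"
    by auto
  show "finite {xs. set xs \<subseteq> range q \<and> length xs = T}"
    by (rule finite_lists_length_eq[OF assms])
qed

text \<open>The new state is the window of \<open>T\<close> old states from \<open>T * n\<close> on.
  It suffices because \<open>T * (C * n + r) + c = C * (T * n) + (T * r + c)\<close> with
  \<open>T * r + c < C * T\<close>, which stays inside the \<open>T\<close> blocks headed by that
  window.\<close>

lemma blocks_agree_progression:
  fixes q :: "nat \<Rightarrow> 's"
  assumes agree: "blocks_agree C f q D" and c: "c < T"
  shows "blocks_agree C (\<lambda>n. f (T * n + c)) (\<lambda>n. map (\<lambda>t. q (T * n + t)) [0..<T])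
           {n. \<exists>t<T. T * n + t \<in> D}"
  unfolding blocks_agree_def
proof (intro allI impI)
  fix n m r
  assume D: "n \<notin> {n. \<exists>t<T. T * n + t \<in> D}" "m \<notin> {n. \<exists>t<T. T * n + t \<in> D}"
    and q: "map (\<lambda>t. q (T * n + t)) [0..<T] = map (\<lambda>t. q (T * m + t)) [0..<T]" and r: "r < C"
  have "q (T * n + t) = q (T * m + t)" if "t < T" for t
    using arg_cong[OF q, of "\<lambda>xs. xs ! t"] that by simp
  moreover have "T * r + c < C * T"
  proof -
    have "T * Suc r \<le> T * C" using r by (intro mult_le_mono) auto
    then show ?thesis using c by (simp add: algebra_simps)
  qed
  ultimately have "f (C * (T * n) + (T * r + c)) = f (C * (T * m) + (T * r + c))"
    using D by (intro blocks_agree_run[OF agree, of T]) auto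
  then show "f (T * (C * n + r) + c) = f (T * (C * m + r) + c)"
    by (simp add: algebra_simps)
qed

lemma state_map_progression:
  assumes "state_map k f q" "c < T"
  shows "state_map k (\<lambda>n. f (T * n + c)) (\<lambda>n. map (\<lambda>t. q (T * n + t)) [0..<T])"
  unfolding state_map_def
proof (intro conjI allI)
  show "finite (range (\<lambda>n. map (\<lambda>t. q (T * n + t)) [0..<T]))"
    using assms by (intro finite_range_map_window) (simp add: state_map_def)
  show "blocks_agree (k ^ a) (\<lambda>n. f (T * n + c)) (\<lambda>n. map (\<lambda>t. q (T * n + t)) [0..<T]) {}" for a
    using blocks_agree_progression[of "k ^ a" f q "{}" c T] assms by (simp add: state_map_def)
qed

lemma asym_state_map_progression:
  assumes "asym_state_map l f q" "c < T"
  shows "asym_state_map l (\<lambda>n. f (T * n + c)) (\<lambda>n. map (\<lambda>t. q (T * n + t)) [0..<T])"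
  unfolding asym_state_map_def
proof (intro conjI allI)
  show "finite (range (\<lambda>n. map (\<lambda>t. q (T * n + t)) [0..<T]))"
    using assms by (intro finite_range_map_window) (simp add: asym_state_map_def)
  fix b
  obtain D where D: "zero_density D" "blocks_agree (l ^ b) f q D"
    using assms by (auto simp: asym_state_map_def)
  have "zero_density (\<Union>t<T. {n. T * n + t \<in> D})"
    using D(1) assms(2) by (intro zero_density_UN zero_density_vimage_affine) auto
  then have "zero_density {n. \<exists>t<T. T * n + t \<in> D}"
    by (rule zero_density_subset) auto
  then show "\<exists>D'. zero_density D' \<and> blocks_agree (l ^ b) (\<lambda>n. f (T * n + c))
      (\<lambda>n. map (\<lambda>t. q (T * n + t)) [0..<T]) D'"
    using blocks_agree_progression[OF D(2) assms(2)] by blast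
qed

text \<open>Off \<open>D b\<close>, the value \<open>g (k ^ b * n)\<close> is read from a table
  indexed by the state of \<open>n\<close>. There are finitely many tables, so two exponents share
  one.\<close>

lemma blocks_agree_pigeonhole:
  fixes g :: "nat \<Rightarrow> 'a::finite"
  assumes fin: "finite (range q)" and agree: "\<And>b :: nat. blocks_agree (k ^ b) g q (D b)"
    and k: "0 < k"
  shows "\<exists>b b'. b < b' \<and> (\<forall>n. n \<notin> D b \<longrightarrow> n \<notin> D b' \<longrightarrow> g (k ^ b * n) = g (k ^ b' * n))"
proof -
  \<comment> \<open>For a state without a head outside \<open>D b\<close> the choice is arbitrary;
    the table is only consulted at states \<open>q n\<close> with \<open>n\<close> outside
    \<open>D b\<close>.\<close>
  define rep where "rep = (\<lambda>b s. SOME m. m \<notin> D b \<and> q m = s)"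
  define \<Phi> where "\<Phi> = (\<lambda>b. restrict (\<lambda>s. g (k ^ b * rep b s)) (range q))"
  have \<Phi>: "g (k ^ b * n) = \<Phi> b (q n)" if "n \<notin> D b" for b n
  proof -
    have "rep b (q n) \<notin> D b \<and> q (rep b (q n)) = q n"
      unfolding rep_def by (rule someI[of _ n]) (use that in simp)
    then have "g (k ^ b * n + 0) = g (k ^ b * rep b (q n) + 0)"
      using that k by (intro blocks_agreeD[OF agree]) auto
    then show ?thesis by (simp add: \<Phi>_def)
  qed
  have "range \<Phi> \<subseteq> PiE (range q) (\<lambda>_. UNIV)" by (auto simp: \<Phi>_def)
  moreover have "finite (PiE (range q) (\<lambda>_. UNIV :: 'a set))"
    using fin by (intro finite_PiE) auto
  ultimately have "finite (range \<Phi>)" by (rule finite_subset)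
  then have "\<not> inj \<Phi>" using finite_imageD infinite_UNIV_nat by blast
  then obtain b b' where "b \<noteq> b'" "\<Phi> b = \<Phi> b'" by (auto simp: inj_def)
  then show ?thesis using \<Phi> by (metis linorder_neqE_nat)
qed

section \<open>Powers of multiplicatively independent integers\<close>

lemma mult_indep_power:
  assumes "mult_indep k l" "0 < a" "0 < b" "2 \<le> k" "2 \<le> l"
  shows "mult_indep (k ^ a) (l ^ b)"
proof -
  have ba: "real b / real a \<in> \<rat>" by auto
  have "ln (real k) / ln (real l) = (ln (real (k ^ a)) / ln (real (l ^ b))) * (real b / real a)"
    using assms by (simp add: ln_realpow field_simps)
  then show ?thesis
    using assms(1) Rats_mult[OF _ ba, of "ln (real (k ^ a)) / ln (real (l ^ b))"]
    unfolding mult_indep_def by metis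
qed

text \<open>After taking logarithms and dividing by \<open>ln l\<close>, this is the density of the
  fractional parts of multiples of an irrational; \<alpha> and \<epsilon> are midpoint and
  half-width of the target interval.\<close>

lemma power_ratios_dense:
  fixes u v :: real
  assumes kl: "2 \<le> k" "2 \<le> l" and indep: "mult_indep k l" and uv: "0 < u" "u < v"
  shows "\<exists>i j. u * l ^ j < k ^ i \<and> k ^ i < v * l ^ j"
proof -
  define \<theta> where "\<theta> = ln (real k) / ln (real l)"
  have lnl: "ln (real l) > 0" and lnk: "ln (real k) > 0" using kl by auto
  then have \<theta>pos: "0 < \<theta>" by (simp add: \<theta>_def)
  define \<alpha> where "\<alpha> = (ln u + ln v) / 2 / ln (real l)"
  define \<epsilon> where "\<epsilon> = (ln v - ln u) / 2 / ln (real l)"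
  have \<epsilon>: "0 < \<epsilon>" using uv lnl by (auto simp: \<epsilon>_def)
  \<comment> \<open>The density theorem gives \<open>m > 0\<close> but no sign for \<open>h\<close>.
    Replacing \<theta> by a large multiple \<open>N * \<theta>\<close> forces \<open>h\<close> to be
    positive, so both exponents are natural numbers.\<close>
  obtain N :: nat where N: "(\<bar>\<alpha>\<bar> + \<epsilon>) / \<theta> < real N" using reals_Archimedean2 by blast
  then have N\<theta>: "\<bar>\<alpha>\<bar> + \<epsilon> < N * \<theta>" using \<theta>pos by (simp add: field_simps)
  then have Npos: "0 < N" using \<epsilon> by (cases N) auto
  have irr: "N * \<theta> \<notin> \<rat>"
  proof
    assume "N * \<theta> \<in> \<rat>"
    then have "N * \<theta> / N \<in> \<rat>" by (intro Rats_divide) auto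
    then show False using indep Npos by (simp add: mult_indep_def \<theta>_def)
  qed
  obtain h m :: int where m: "0 < m" and hm: "\<bar>of_int m * (N * \<theta>) - of_int h - \<alpha>\<bar> < \<epsilon>"
    using sequence_of_fractional_parts_is_dense[OF irr \<epsilon>] by metis
  have "N * \<theta> \<le> of_int m * (N * \<theta>)"
    using mult_right_mono[of 1 "of_int m" "N * \<theta>"] m \<theta>pos by simp
  then have "0 < real_of_int h" using hm N\<theta> by linarith
  then have h: "0 \<le> h" by linarith
  define i j where "i = nat m * N" and "j = nat h"
  have "\<bar>i * \<theta> - j - \<alpha>\<bar> < \<epsilon>" using hm m h by (simp add: i_def j_def mult.assoc)
  then have "(\<alpha> - \<epsilon>) * ln l < (i * \<theta> - j) * ln l" "(i * \<theta> - j) * ln l < (\<alpha> + \<epsilon>) * ln l"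
    using lnl by (auto intro!: mult_strict_right_mono)
  moreover have "(\<alpha> - \<epsilon>) * ln l = ln u" "(\<alpha> + \<epsilon>) * ln l = ln v"
    "(i * \<theta> - j) * ln l = i * ln k - j * ln l"
    using lnl by (auto simp: \<alpha>_def \<epsilon>_def \<theta>_def field_simps)
  ultimately have "ln u + j * ln l < i * ln k" "i * ln k < ln v + j * ln l" by linarith+
  moreover have "ln (u * real l ^ j) = ln u + j * ln l" "ln (v * real l ^ j) = ln v + j * ln l"
    "ln (real k ^ i) = i * ln k"
    using uv kl by (simp_all add: ln_mult ln_realpow)
  ultimately have "ln (u * real l ^ j) < ln (real k ^ i)" "ln (real k ^ i) < ln (v * real l ^ j)"
    by simp_all
  then show ?thesis using uv kl by (intro exI[of _ i] exI[of _ j]) (auto simp: ln_less_cancel_iff)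
qed

section \<open>Local periods\<close>

text \<open>If \<open>a = k ^ \<alpha>\<close> and \<open>b = l ^ \<beta>\<close> are close and the states at \<open>j\<^sub>1 < j\<^sub>2\<close> agree in both bases,
  then \<open>f\<close> is locally invariant under the shifts by \<open>a * (j\<^sub>2 - j\<^sub>1)\<close> and \<open>b * (j\<^sub>2 - j\<^sub>1)\<close>,
  hence under their small difference.\<close>

lemma local_period_of_frequent_pair:
  fixes q :: "nat \<Rightarrow> 's" and F :: "nat \<Rightarrow> 't"
  assumes b: "0 < b" "b < a"
    and agree_a: "blocks_agree a f q {}" and agree_b: "blocks_agree b f F D"
    and D: "zero_density D" and fin: "finite (range F)"
    and window: "\<And>D'. zero_density D' \<Longrightarrow>
      \<exists>n. n \<notin> D' \<and> card (range F) ^ 3 <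
        card ({j. (q j, q (Suc j)) = (q i, q (Suc i))} \<inter> {n..<n + H})"
  shows "\<exists>p>0. p \<le> (a - b) * H \<and>
           (\<forall>z. z + 2 * ((a - b) * H) \<le> 2 * a \<longrightarrow> f (a * i + z + p) = f (a * i + z))"
proof -
  \<comment> \<open>Bad \<open>n\<close> are those for which one of the next \<open>H + 3\<close>
    blocks of length \<open>b\<close> from \<open>a * n\<close> on has its head in \<open>D\<close>:
    offsets below \<open>H\<close> within the window, plus up to two more for a run of three blocks.
    As \<open>b < a\<close>, the map to the first head is injective.\<close>
  have "zero_density (\<Union>t<H + 3. {n. a * n div b \<in> {m. 1 * m + t \<in> D}})"
  proof (rule zero_density_UN)
    fix t
    have "zero_density {m. 1 * m + t \<in> D}"
      by (rule zero_density_vimage_affine[OF D]) simp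
    then show "zero_density {n. a * n div b \<in> {m. 1 * m + t \<in> D}}"
    proof (rule zero_density_vimage[where C = a])
      have "a * n div b < a * Suc n div b" for n
      proof -
        have "a * n div b < (a * n + b) div b" using b by simp
        also have "\<dots> \<le> a * Suc n div b" using b by (intro div_le_mono) simp
        finally show ?thesis .
      qed
      then have "strict_mono (\<lambda>n. a * n div b)" by (simp add: strict_mono_Suc_iff)
      then show "inj (\<lambda>n. a * n div b)" by (rule strict_mono_imp_inj_on)
      show "a * n div b < a * Suc n" for n
        using b by (intro le_less_trans[OF div_le_dividend]) simp
    qed
  qed simp
  from window[OF this] obtain n where
    nD: "n \<notin> (\<Union>t<H + 3. {n. a * n div b \<in> {m. 1 * m + t \<in> D}})"
    and big: "card (range F) ^ 3 <
      card ({j. (q j, q (Suc j)) = (q i, q (Suc i))} \<inter> {n..<n + H})"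
    by blast
  have good: "a * n div b + t \<notin> D" if "t < H + 3" for t using nD that by auto
  define W where "W = {j. (q j, q (Suc j)) = (q i, q (Suc i))} \<inter> {n..<n + H}"
  have "b * n \<le> a * n" using b by simp
  then have "n \<le> a * n div b" using b by (simp add: less_eq_div_iff_mult_less_eq mult.commute)
  then obtain s where s: "a * n div b = n + s" using le_Suc_ex by blast
  define \<rho> where "\<rho> = a * n mod b"
  have \<rho>: "\<rho> < b" "a * n = b * (n + s) + \<rho>"
    using b mult_div_mod_eq[of b "a * n"] by (auto simp: \<rho>_def s)
  \<comment> \<open>Triples of \<open>F\<close>-states, whence the cube in the window bound. Three
    blocks of length \<open>b\<close> are needed because the drift between the two grids and the
    offset \<rho> are added to a position inside two blocks of length \<open>a\<close>.\<close>
  define \<Psi> where "\<Psi> = (\<lambda>j. (F (j + s), F (j + s + 1), F (j + s + 2)))"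
  have "card (\<Psi> ` W) \<le> card (range F \<times> range F \<times> range F)"
    using fin by (intro card_mono) (auto simp: \<Psi>_def)
  also have "\<dots> = card (range F) ^ 3" by (simp add: card_cartesian_product power3_eq_cube)
  finally have "\<not> inj_on \<Psi> W" using big by (intro pigeonhole) (simp add: W_def)
  then obtain j1 j2 where j: "j1 \<in> W" "j2 \<in> W" "j1 < j2" "\<Psi> j1 = \<Psi> j2"
    unfolding inj_on_def by (metis linorder_neqE_nat)
  obtain t where t: "j1 = n + t" using j(1) le_Suc_ex by (auto simp: W_def)
  obtain e where e: "j2 = n + t + e" "0 < e"
    using j(3) t less_imp_add_positive by (metis)
  have teH: "t + e < H" using j(2) e by (simp add: W_def)
  obtain d where d: "a = b + d" "0 < d" using b(2) less_imp_add_positive by metis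
  have dH: "d * t + d * e + d \<le> d * H"
  proof -
    have "d * (t + e + 1) \<le> d * H" using teH by (intro mult_le_mono) auto
    then show ?thesis by (simp add: algebra_simps)
  qed
  have run_a: "f (a * i + z) = f (a * j + z)" if "j \<in> W" "z < 2 * a" for j z
  proof (rule blocks_agree_run[OF agree_a, of 2])
    show "i + t \<notin> {} \<and> j + t \<notin> {} \<and> q (i + t) = q (j + t)" if "t < 2" for t
    proof -
      have "t = 0 \<or> t = 1" using that by linarith
      then show ?thesis using \<open>j \<in> W\<close> by (auto simp: W_def)
    qed
  qed (use that in simp)
  have run_b: "f (b * (j1 + s) + w) = f (b * (j2 + s) + w)" if "w < 3 * b" for w
  proof (rule blocks_agree_run[OF agree_b, of 3])
    fix u :: nat assume u: "u < 3"
    have "u = 0 \<or> u = 1 \<or> u = 2" using u by linarith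
    then have "F (j1 + s + u) = F (j2 + s + u)" using j(4) by (auto simp: \<Psi>_def)
    moreover have "a * n div b + (t + u) = j1 + s + u" "a * n div b + (t + e + u) = j2 + s + u"
      using t e s by auto
    moreover have "a * n div b + (t + u) \<notin> D" "a * n div b + (t + e + u) \<notin> D"
      using u teH by (auto intro!: good)
    ultimately show "j1 + s + u \<notin> D \<and> j2 + s + u \<notin> D \<and> F (j1 + s + u) = F (j2 + s + u)"
      by metis
  qed (use that in simp)
  have "f (a * i + z + d * e) = f (a * i + z)" if z: "z + 2 * (d * H) \<le> 2 * a" for z
  proof -
    \<comment> \<open>The distance \<open>a * j - b * (j + s)\<close> is
      \<open>\<rho> + d * t\<close> at \<open>j1\<close> and \<open>\<rho> + d * (t + e)\<close> at
      \<open>j2\<close>. One offset \<open>w\<close> therefore meets positions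
      \<open>z + d * e\<close> and \<open>z\<close> of the two blocks of length \<open>a\<close>,
      giving the period \<open>d * e\<close>.\<close>
    define w where "w = \<rho> + d * t + z + d * e"
    have "f (a * i + (z + d * e)) = f (a * j1 + (z + d * e))"
      using z dH d j(1) by (intro run_a) auto
    also have "a * j1 + (z + d * e) = b * (j1 + s) + w"
      using \<rho>(2) t d by (simp add: w_def algebra_simps)
    also have "f (b * (j1 + s) + w) = f (b * (j2 + s) + w)"
      using z dH d \<rho>(1) by (intro run_b) (auto simp: w_def)
    also have "b * (j2 + s) + w = a * j2 + z"
      using \<rho>(2) t e d by (simp add: w_def algebra_simps)
    also have "f (a * j2 + z) = f (a * i + z)"
      using z dH d j(2) by (intro run_a[symmetric]) auto
    finally show ?thesis by (simp add: add.assoc)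
  qed
  moreover have "d * e \<le> d * H" "0 < d * e" using teH d e by auto
  moreover have "a - b = d" using d by simp
  ultimately show ?thesis by (intro exI[of _ "d * e"]) simp
qed

lemma period_iterate:
  fixes p :: nat
  assumes "\<And>z. z \<le> M \<Longrightarrow> g (z + p) = g z" "u + p * m \<le> M + p"
  shows "g (u + p * m) = g u"
  using assms(2)
proof (induction m)
  case (Suc m)
  have "g (u + p * Suc m) = g (u + p * m + p)" by (simp add: algebra_simps)
  also have "\<dots> = g (u + p * m)" using Suc.prems by (intro assms(1)) simp
  also have "\<dots> = g u" using Suc.prems by (intro Suc.IH) simp
  finally show ?case .
qed simp

text \<open>The period found on the first window propagates through the overlaps, where the period of
  the next window allows to translate back into the part already treated.\<close>

lemma period_chain:
  fixes a i r P :: nat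
  assumes loc: "\<And>j. i \<le> j \<Longrightarrow> j \<le> i + r \<Longrightarrow>
      \<exists>p>0. p \<le> P \<and> (\<forall>z. z + 2 * P \<le> 2 * a \<longrightarrow> f (a * j + z + p) = f (a * j + z))"
    and P: "4 * P \<le> a"
  shows "\<exists>p>0. p \<le> P \<and> (\<forall>z. z + 3 * P \<le> a * (r + 2) \<longrightarrow> f (a * i + z + p) = f (a * i + z))"
  using loc
proof (induction r)
  case 0
  obtain p where p: "p > 0" "p \<le> P" "\<And>z. z + 2 * P \<le> 2 * a \<Longrightarrow> f (a * i + z + p) = f (a * i + z)"
    using 0[of i] by auto
  then show ?case by (intro exI[of _ p]) auto
next
  case (Suc r)
  obtain p where p: "p > 0" "p \<le> P"
    "\<And>z. z + 3 * P \<le> a * (r + 2) \<Longrightarrow> f (a * i + z + p) = f (a * i + z)"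
    using Suc.IH Suc.prems by (metis add_Suc_right le_SucI)
  define g where "g = (\<lambda>z. f (a * (i + Suc r) + z))"
  obtain p' where p': "p' > 0" "p' \<le> P" "\<And>z. z + 2 * P \<le> 2 * a \<Longrightarrow> g (z + p') = g z"
    using Suc.prems[of "i + Suc r"] by (auto simp: g_def add.assoc)
  have "f (a * i + z + p) = f (a * i + z)" if z: "z + 3 * P \<le> a * (Suc r + 2)" for z
  proof (cases "z + 3 * P \<le> a * (r + 2)")
    case False
    then have "a * (r + 1) \<le> z" using P by simp
    then obtain x where x: "z = a * (r + 1) + x" using le_Suc_ex by blast
    have x2: "x + 3 * P \<le> 2 * a" using z by (simp add: x algebra_simps)
    \<comment> \<open>Both \<open>x\<close> and \<open>x + p\<close> are moved back by the same
      multiple of \<open>p'\<close>. The remainder \<open>x0\<close> is below \<open>P\<close>, so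
      \<open>4 * P \<le> a\<close> puts it where the period \<open>p\<close> is already
      known.\<close>
    define x0 where "x0 = x mod p'"
    have x0: "x = x0 + p' * (x div p')" "x0 < p'" using p' by (auto simp: x0_def)
    have iter: "g (v + p' * (x div p')) = g v" if "v + p' * (x div p') + 2 * P \<le> 2 * a" for v
      by (rule period_iterate[where M = "2 * a - 2 * P"]) (use that p'(3) in auto)
    have "g x = g x0" using iter[of x0] x0(1) x2 by simp
    moreover have "g (x + p) = g (x0 + p)"
    proof -
      have eq: "x + p = x0 + p + p' * (x div p')" using x0(1) by linarith
      have "g (x0 + p + p' * (x div p')) = g (x0 + p)" using eq x2 p(2) by (intro iter) linarith
      then show ?thesis by (simp only: eq)
    qed
    moreover have "g (x0 + p) = g x0"
    proof -
      have "a * (r + 1) + x0 + 3 * P \<le> a * (r + 2)" using x0(2) p'(2) P by simp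
      from p(3)[OF this] show ?thesis by (simp add: g_def algebra_simps)
    qed
    ultimately have "g (x + p) = g x" by simp
    then show ?thesis by (simp add: g_def x algebra_simps)
  qed (use p in blast)
  then show ?case using p(1,2) by blast
qed

section \<open>Merging local periods into a global almost-period\<close>

lemma almost_everywhere_shift_invariant:
  fixes f :: "nat \<Rightarrow> 'a" and q :: "nat \<Rightarrow> 's" and F :: "nat \<Rightarrow> 't"
  assumes kl: "2 \<le> k" "2 \<le> l" and indep: "mult_indep k l"
    and q: "state_map k f q" and F: "asym_state_map l f F"
  shows "\<exists>T>0. zero_density {y. f (y + T) \<noteq> f y}"
proof -
  define \<pi> where "\<pi> = (\<lambda>i. (q i, q (Suc i)))"
  define K where "K = card (range F) ^ 3"
  have finF: "finite (range F)" using F by (simp add: asym_state_map_def)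
  have "range \<pi> \<subseteq> range q \<times> range q" by (auto simp: \<pi>_def)
  then have fin\<pi>: "finite (range \<pi>)" 
    using q by (intro finite_subset[of "range \<pi>"]) (auto simp: state_map_def)
  have "\<forall>\<^sub>F H in sequentially. \<forall>\<sigma>\<in>{\<sigma> \<in> range \<pi>. \<not> zero_density {j. \<pi> j = \<sigma>}}.
      \<forall>D. zero_density D \<longrightarrow> (\<exists>n. n \<notin> D \<and> K < card ({j. \<pi> j = \<sigma>} \<inter> {n..<n + H}))"
    using fin\<pi> by (intro eventually_ball_finite ballI eventually_dense_window) auto
  then have "\<forall>\<^sub>F H in sequentially. 0 < H \<and> (\<forall>\<sigma>\<in>{\<sigma> \<in> range \<pi>. \<not> zero_density {j. \<pi> j = \<sigma>}}.
      \<forall>D. zero_density D \<longrightarrow> (\<exists>n. n \<notin> D \<and> K < card ({j. \<pi> j = \<sigma>} \<inter> {n..<n + H})))"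
    using eventually_gt_at_top[of 0] by eventually_elim auto
  then obtain H where H: "0 < H" and window:
    "\<And>i D'. \<not> zero_density {j. \<pi> j = \<pi> i} \<Longrightarrow> zero_density D' \<Longrightarrow>
      \<exists>n. n \<notin> D' \<and> K < card ({j. \<pi> j = \<pi> i} \<inter> {n..<n + H})"
    unfolding eventually_sequentially by blast
  \<comment> \<open>The upper bound on the ratio is equivalent to
    \<open>4 * (a - b) * H < a\<close>, the overlap condition for chaining periods; this is why
    \<open>H\<close> is fixed before the powers.\<close>
  obtain \<alpha> \<beta> where "1 * real l ^ \<beta> < real k ^ \<alpha>"
    "real k ^ \<alpha> < (4 * real H / (4 * real H - 1)) * real l ^ \<beta>"
    using power_ratios_dense[OF kl indep, of 1 "4 * real H / (4 * real H - 1)"] H by (auto simp: field_simps)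
  note ratio = this
  define a b where "a = k ^ \<alpha>" and "b = l ^ \<beta>"
  have ab: "0 < b" "b < a"
    using ratio(1) kl by (simp_all add: a_def b_def flip: of_nat_power)
  define P where "P = (a - b) * H"
  have P: "4 * P \<le> a"
  proof -
    have "real a < (4 * real H / (4 * real H - 1)) * real b" using ratio(2) by (simp add: a_def b_def)
    then have "real a * (4 * real H - 1) < 4 * real H * real b" using H by (simp add: field_simps)
    then have "4 * ((real a - real b) * H) < real a" by (simp add: algebra_simps)
    moreover have "real P = (real a - real b) * H" using ab by (simp add: P_def of_nat_diff)
    ultimately show ?thesis by linarith
  qed
  obtain D where D: "zero_density D" "blocks_agree b f F D"
    using F by (auto simp: asym_state_map_def b_def)
  have agree_a: "blocks_agree a f q {}" using q by (simp add: state_map_def a_def)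
  have loc: "\<exists>p>0. p \<le> P \<and> (\<forall>z. z + 2 * P \<le> 2 * a \<longrightarrow> f (a * i + z + p) = f (a * i + z))"
    if "\<not> zero_density {j. \<pi> j = \<pi> i}" for i
    unfolding P_def
    by (rule local_period_of_frequent_pair[OF ab agree_a D(2,1) finF])
       (use window[OF that] in \<open>simp add: \<pi>_def K_def\<close>)
  define E where "E = {i. zero_density {j. \<pi> j = \<pi> i}}"
  have E: "zero_density E" unfolding E_def by (rule zero_density_infrequent_values[OF fin\<pi>])
  \<comment> \<open>The local period varies from place to place but never exceeds \<open>P\<close>,
    so it always divides \<open>P\<close> factorial.\<close>
  define T :: nat where "T = fact P"
  have "zero_density {y. y div a \<in> (\<Union>t\<le>T. {i. 1 * i + t \<in> E})}"
    using ab by (intro zero_density_div zero_density_UN zero_density_vimage_affine E) auto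
  moreover have "{y. f (y + T) \<noteq> f y} \<subseteq> {y. y div a \<in> (\<Union>t\<le>T. {i. 1 * i + t \<in> E})}"
  proof (rule subsetI, rule ccontr)
    fix y assume y: "y \<in> {y. f (y + T) \<noteq> f y}"
      and good: "y \<notin> {y. y div a \<in> (\<Union>t\<le>T. {i. 1 * i + t \<in> E})}"
    define i where "i = y div a"
    have freq: "\<not> zero_density {j. \<pi> j = \<pi> j'}" if j': "i \<le> j'" "j' \<le> i + T" for j'
    proof -
      obtain t where "j' = i + t" using j'(1) le_Suc_ex by blast
      moreover from this have "t \<le> T" using j'(2) by simp
      ultimately show ?thesis using good by (auto simp: i_def E_def)
    qed
    obtain p where p: "0 < p" "p \<le> P"
      "\<And>z. z + 3 * P \<le> a * (T + 2) \<Longrightarrow> f (a * i + z + p) = f (a * i + z)"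
      using period_chain[OF loc[OF freq] P, of i T] by blast
    have "p dvd T" unfolding T_def using p by (intro dvd_fact) auto
    then obtain m where m: "T = p * m" by (elim dvdE)
    define z where "z = y mod a"
    have yz: "y = a * i + z" "z < a" using ab by (auto simp: z_def i_def)
    have "(\<lambda>z. f (a * i + z)) (z + p * m) = (\<lambda>z. f (a * i + z)) z"
    proof (rule period_iterate[where M = "a * (T + 2) - 3 * P"])
      show "f (a * i + (v + p)) = f (a * i + v)" if "v \<le> a * (T + 2) - 3 * P" for v
        using p(3)[of v] that P by (simp add: add.assoc)
      have "T \<le> a * T" using ab by simp
      moreover have "a * (T + 2) = a * T + 2 * a" by simp
      ultimately have "z + T + 3 * P \<le> a * (T + 2)" using yz(2) P by linarith
      then show "z + p * m \<le> a * (T + 2) - 3 * P + p" using m by simp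
    qed
    then have "f (y + T) = f y" using yz m by (simp add: add.assoc)
    with y show False by simp
  qed
  ultimately have "zero_density {y. f (y + T) \<noteq> f y}" by (rule zero_density_subset)
  moreover have "0 < T" by (simp add: T_def)
  ultimately show ?thesis by blast
qed

section \<open>Slowly varying sequences\<close>

text \<open>The indices whose block contains a jump of \<open>g\<close> have density zero, so some
  \<open>m\<close> with the state of \<open>n\<close> has a block without jumps, and the block of
  \<open>n\<close> is a copy of it.\<close>

lemma constant_on_frequent_blocks:
  assumes q: "state_map k g q" and k: "0 < k" and slow: "zero_density {n. g (Suc n) \<noteq> g n}"
    and freq: "\<not> zero_density {m. q m = q n}" and r: "r < k ^ a"
  shows "g (k ^ a * n + r) = g (k ^ a * n)"
proof -
  have "zero_density (\<Union>r<k ^ a. {m. k ^ a * m + r \<in> {n. g (Suc n) \<noteq> g n}})"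
    using k by (intro zero_density_UN zero_density_vimage_affine slow) auto
  then have "\<not> {m. q m = q n} \<subseteq> (\<Union>r<k ^ a. {m. k ^ a * m + r \<in> {n. g (Suc n) \<noteq> g n}})"
    using freq zero_density_subset by blast
  then obtain m where m: "q m = q n" "\<And>r. r < k ^ a \<Longrightarrow> g (Suc (k ^ a * m + r)) = g (k ^ a * m + r)"
    by auto
  have "g (k ^ a * m + r') = g (k ^ a * m)" if "r' < k ^ a" for r'
    using that by (induction r') (auto simp: m(2))
  moreover have "g (k ^ a * n + r') = g (k ^ a * m + r')" if "r' < k ^ a" for r'
    using q m(1) that by (intro blocks_agreeD[of "k ^ a" g q "{}"]) (auto simp: state_map_def)
  ultimately show ?thesis using r k by (metis add_0_right zero_less_power)
qed

lemma slowly_varying_asym_constant: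
  fixes g :: "nat \<Rightarrow> 'a::finite" and q :: "nat \<Rightarrow> 's" and F :: "nat \<Rightarrow> 't"
  assumes kl: "2 \<le> k" "2 \<le> l" and indep: "mult_indep k l"
    and q: "state_map k g q" and F: "asym_state_map l g F"
    and slow: "zero_density {n. g (Suc n) \<noteq> g n}"
  shows "\<exists>A. zero_density {n. g n \<noteq> A}"
proof -
  have k: "0 < k" and l: "0 < l" using kl by auto
  have "\<exists>a0 a'. a0 < a' \<and> (\<forall>n. n \<notin> {} \<longrightarrow> n \<notin> {} \<longrightarrow> g (k ^ a0 * n) = g (k ^ a' * n))"
    using q k by (intro blocks_agree_pigeonhole) (auto simp: state_map_def)
  then obtain a0 a' where a': "a0 < a'" "\<And>n. g (k ^ a0 * n) = g (k ^ a' * n)" by auto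
  obtain a where a: "a' = a0 + a" "0 < a" using a'(1) less_imp_add_positive by metis
  have iter_k: "g (k ^ (a0 + a * j) * n) = g (k ^ a0 * n)" for j n
  proof (induction j arbitrary: n)
    case (Suc j)
    have "g (k ^ (a0 + a * Suc j) * n) = g (k ^ a' * (k ^ (a * j) * n))"
      by (simp add: a power_add algebra_simps)
    also have "\<dots> = g (k ^ (a0 + a * j) * n)"
      by (subst a'(2)[symmetric]) (simp add: power_add algebra_simps)
    finally show ?case using Suc by simp
  qed simp
  obtain D where D: "\<And>b. zero_density (D b)" "\<And>b. blocks_agree (l ^ b) g F (D b)"
    using F unfolding asym_state_map_def by metis
  have "\<exists>b0 b'. b0 < b' \<and> (\<forall>n. n \<notin> D b0 \<longrightarrow> n \<notin> D b' \<longrightarrow> g (l ^ b0 * n) = g (l ^ b' * n))"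
    using F l D(2) by (intro blocks_agree_pigeonhole[where q = F]) (auto simp: asym_state_map_def)
  then obtain b0 b' where b': "b0 < b'"
    "\<And>n. n \<notin> D b0 \<Longrightarrow> n \<notin> D b' \<Longrightarrow> g (l ^ b0 * n) = g (l ^ b' * n)" by blast
  obtain b where b: "b' = b0 + b" "0 < b" using b'(1) less_imp_add_positive by metis
  have step_l: "zero_density {n. g (l ^ b' * n) \<noteq> g (l ^ b0 * n)}"
    by (rule zero_density_subset[OF zero_density_Un[OF D(1)[of b0] D(1)[of b']]])
       (use b'(2) in fastforce)
  \<comment> \<open>In base \<open>l\<close> each multiplication adds an exceptional set; for a
    fixed \<open>i\<close> finitely many are united.\<close>
  have iter_l: "zero_density {n. g (l ^ (b0 + b * i) * n) \<noteq> g (l ^ b0 * n)}" for i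
  proof (induction i)
    case 0
    then show ?case by (simp add: zero_density_finite)
  next
    case (Suc i)
    have *: "zero_density {n. l ^ (b * i) * n + 0 \<in> {n. g (l ^ b' * n) \<noteq> g (l ^ b0 * n)}}"
      using l by (intro zero_density_vimage_affine step_l) auto
    show ?case
    proof (rule zero_density_subset[OF zero_density_Un[OF * Suc.IH]], intro subsetI, rule ccontr)
      fix n
      assume n: "n \<in> {n. g (l ^ (b0 + b * Suc i) * n) \<noteq> g (l ^ b0 * n)}"
        "n \<notin> {n. l ^ (b * i) * n + 0 \<in> {n. g (l ^ b' * n) \<noteq> g (l ^ b0 * n)}}
           \<union> {n. g (l ^ (b0 + b * i) * n) \<noteq> g (l ^ b0 * n)}"
      have eqs: "l ^ (b0 + b * Suc i) * n = l ^ b' * (l ^ (b * i) * n)"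
        "l ^ (b0 + b * i) * n = l ^ b0 * (l ^ (b * i) * n)"
        by (simp_all add: b power_add algebra_simps)
      from n show False unfolding Un_iff mem_Collect_eq eqs by simp
    qed
  qed
  \<comment> \<open>Zero is added so that the quotient by \<open>n'\<close> below is
    meaningful.\<close>
  define E where "E = insert 0 {n. zero_density {m. q m = q n}}"
  have "zero_density ({0} \<union> {n. zero_density {m. q m = q n}})"
    using q by (intro zero_density_Un zero_density_infrequent_values zero_density_finite)
      (auto simp: state_map_def)
  then have E: "zero_density E" by (simp add: E_def)
  have const: "g x = g (k ^ a0 * n)"
    if x: "n \<notin> E" "k ^ (a0 + a * j) * n \<le> x" "x < k ^ (a0 + a * j) * Suc n" for n x j
  proof -
    obtain r where "x = k ^ (a0 + a * j) * n + r" using x(2) le_Suc_ex by blast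
    then have "g x = g (k ^ (a0 + a * j) * n)"
      using x by (auto simp: E_def intro: constant_on_frequent_blocks[OF q k slow])
    then show ?thesis by (simp add: iter_k)
  qed
  have same: "g (k ^ a0 * n) = g (k ^ a0 * n')" if n: "n \<notin> E" "n' \<notin> E" for n n'
  proof (rule ccontr)
    assume neq: "g (k ^ a0 * n) \<noteq> g (k ^ a0 * n')"
    have pos: "0 < n" "0 < n'" using n by (auto simp: E_def intro: gr0I)
    \<comment> \<open>A ratio \<open>Kc / Lc\<close> strictly between these bounds makes the
      interval from \<open>Lc * n\<close> to \<open>Lc * Suc n\<close> overlap the one from
      \<open>Kc * n'\<close> to \<open>Kc * Suc n'\<close>.\<close>
    have "real n / (n' + 1) < real (n + 1) / n'"
      using pos by (simp add: field_simps)
    then obtain j i where ji: "real n / (n' + 1) * (l ^ b) ^ i < (k ^ a) ^ j"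
      "(k ^ a) ^ j < real (n + 1) / n' * (l ^ b) ^ i"
      using power_ratios_dense[of "k ^ a" "l ^ b" "real n / (n' + 1)" "real (n + 1) / n'"]
        mult_indep_power[OF indep a(2) b(2) kl] kl a b pos self_le_power[of k a] self_le_power[of l b]
      by fastforce
    define Lc Kc where "Lc = l ^ (b * i)" and "Kc = k ^ (a * j)"
    have "real (Lc * n) < real (Kc * Suc n')" "real (Kc * n') < real (Lc * Suc n)"
      using ji pos by (simp_all add: Lc_def Kc_def power_mult field_simps)
    then have overlap: "Lc * n < Kc * Suc n'" "Kc * n' < Lc * Suc n" 
      unfolding of_nat_less_iff .
    have "0 < Lc" "0 < Kc" using k l by (simp_all add: Lc_def Kc_def)
    \<comment> \<open>The unit interval from \<open>u\<close> to \<open>Suc u\<close> lies in both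
      scaled blocks.\<close>
    define u where "u = max (Lc * n) (Kc * n')"
    have u: "Lc * n \<le> u" "Suc u \<le> Lc * Suc n" "Kc * n' \<le> u" "Suc u \<le> Kc * Suc n'"
      using overlap \<open>0 < Lc\<close> \<open>0 < Kc\<close> by (auto simp: u_def)
    define c where "c = l ^ (b0 + b * i)"
    have c: "0 < c" "c = l ^ b0 * Lc" using l by (auto simp: c_def Lc_def power_add)
    define D' where "D' = {w. w div c \<in> {m. g (l ^ (b0 + b * i) * m) \<noteq> g (l ^ b0 * m)}}"
    have "zero_density D'" unfolding D'_def using c by (intro zero_density_div iter_l)
    moreover have "\<exists>X\<ge>X0. {X * u + c..<X * Suc u} \<subseteq> D'" for X0
    proof (intro exI conjI)
      \<comment> \<open>Enlarge the overlap by \<open>?X\<close>. There \<open>c * m\<close> lies in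
        a block over \<open>n'\<close>, while division by \<open>Lc\<close> puts
        \<open>l ^ b0 * m\<close> in a block over \<open>n\<close>. The values differ, so
        \<open>m\<close> is exceptional for \<open>iter_l\<close>. The margin \<open>c\<close> at
        the left keeps \<open>c * (w div c)\<close> in the interval.\<close>
      let ?X = "k ^ (a0 + a * X0)"
      have "X0 \<le> a0 + a * X0" using a by (simp add: trans_le_add2)
      also have "\<dots> \<le> ?X" using kl by (intro less_imp_le power_gt_expt) simp
      finally show "X0 \<le> ?X" .
      show "{?X * u + c..<?X * Suc u} \<subseteq> D'"
      proof
        fix w assume w: "w \<in> {?X * u + c..<?X * Suc u}"
        define m where "m = w div c"
        have "c * m \<le> w" "w < c * m + c"
          using c dividend_less_times_div[of c w] by (auto simp: m_def)
        then have cm: "?X * u \<le> c * m" "c * m < ?X * Suc u" using w by auto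
        have "Lc * (?X * n) \<le> Lc * (l ^ b0 * m)"
        proof -
          have "?X * (Lc * n) \<le> ?X * u" using u by (intro mult_le_mono) auto
          then have "?X * (Lc * n) \<le> c * m" using cm(1) by linarith
          then show ?thesis by (simp only: c(2) ac_simps)
        qed
        moreover have "Lc * (l ^ b0 * m) < Lc * (?X * Suc n)"
        proof -
          have "?X * Suc u \<le> ?X * (Lc * Suc n)" using u by (intro mult_le_mono) auto
          then have "c * m < ?X * (Lc * Suc n)" using cm(2) by linarith
          then show ?thesis by (simp only: c(2) ac_simps)
        qed
        ultimately have "?X * n \<le> l ^ b0 * m" "l ^ b0 * m < ?X * Suc n"
          using \<open>0 < Lc\<close> by (simp_all del: mult_Suc_right)
        then have 1: "g (l ^ b0 * m) = g (k ^ a0 * n)" by (rule const[OF n(1)])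
        have XK: "k ^ (a0 + a * (X0 + j)) = ?X * Kc" by (simp add: Kc_def power_add algebra_simps)
        have "?X * Kc * n' \<le> c * m"
        proof -
          have "?X * (Kc * n') \<le> ?X * u" using u by (intro mult_le_mono) auto
          then have "?X * (Kc * n') \<le> c * m" using cm(1) by linarith
          then show ?thesis by (simp only: mult.assoc)
        qed
        moreover have "c * m < ?X * Kc * Suc n'"
        proof -
          have "?X * Suc u \<le> ?X * (Kc * Suc n')" using u by (intro mult_le_mono) auto
          then have "c * m < ?X * (Kc * Suc n')" using cm(2) by linarith
          then show ?thesis by (simp only: mult.assoc)
        qed
        ultimately have 2: "g (c * m) = g (k ^ a0 * n')"
          by (intro const[OF n(2), of "X0 + j"]) (simp_all only: XK)
        show "w \<in> D'" using 1 2 neq by (simp add: D'_def m_def c_def)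
      qed
    qed
    ultimately show False by (rule zero_density_not_long_intervals)
  qed
  obtain A where A: "\<And>n. n \<notin> E \<Longrightarrow> g (k ^ a0 * n) = A" using same by metis
  have "zero_density {x. x div k ^ a0 \<in> E}" using k by (intro zero_density_div E) simp
  moreover have "{x. g x \<noteq> A} \<subseteq> {x. x div k ^ a0 \<in> E}"
  proof (rule subsetI, rule ccontr)
    fix x assume x: "x \<in> {x. g x \<noteq> A}" "x \<notin> {x. x div k ^ a0 \<in> E}"
    then have "g x = g (k ^ a0 * (x div k ^ a0))"
      using k dividend_less_times_div[of "k ^ a0" x] by (intro const[where j = 0]) auto
    with x A show False by simp
  qed
  ultimately have "zero_density {x. g x \<noteq> A}" by (rule zero_density_subset)
  then show ?thesis by blast
qed

section \<open>Gluing the residue classes modulo the almost-period\<close>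

theorem theoremB:
  fixes f :: "nat \<Rightarrow> 'a::finite" and k l :: nat
  assumes "k \<ge> 2" and "l \<ge> 2" and "mult_indep k l"
    and "automatic k f" and "asym_automatic l f"
  shows "\<exists>g :: nat \<Rightarrow> 'a. periodic g \<and> asym_eq f g"
proof -
  obtain q :: "nat \<Rightarrow> (nat \<Rightarrow> 'a) \<Rightarrow> 'a" where q: "state_map k f q"
    using state_map_exists[OF assms(4)] by blast
  obtain F :: "nat \<Rightarrow> (nat \<Rightarrow> 'a) \<Rightarrow> 'a" where F: "asym_state_map l f F"
    using asym_state_map_exists[OF assms(5)] by blast
  obtain T where T: "0 < T" "zero_density {y. f (y + T) \<noteq> f y}"
    using almost_everywhere_shift_invariant[OF assms(1-3) q F] by blast
  \<comment> \<open>Along a residue class modulo \<open>T\<close>, the shift by \<open>T\<close>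
    becomes the successor, so the subsequence varies slowly.\<close>
  have "\<exists>A. zero_density {n. f (T * n + c) \<noteq> A}" if c: "c < T" for c
  proof (rule slowly_varying_asym_constant[OF assms(1-3) state_map_progression[OF q c]
        asym_state_map_progression[OF F c]])
    have "zero_density {n. T * n + c \<in> {y. f (y + T) \<noteq> f y}}"
      using T by (intro zero_density_vimage_affine)
    then show "zero_density {n. f (T * Suc n + c) \<noteq> f (T * n + c)}"
      by (simp add: algebra_simps)
  qed
  then obtain A where A: "\<And>c. c < T \<Longrightarrow> zero_density {n. f (T * n + c) \<noteq> A c}" by metis
  define g where "g = (\<lambda>n. A (n mod T))"
  have "zero_density {x. x div T \<in> (\<Union>c<T. {n. f (T * n + c) \<noteq> A c})}"
    using T A by (intro zero_density_div zero_density_UN) auto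
  moreover have "{x. f x \<noteq> g x} \<subseteq> {x. x div T \<in> (\<Union>c<T. {n. f (T * n + c) \<noteq> A c})}"
  proof
    fix x assume "x \<in> {x. f x \<noteq> g x}"
    then have "f (T * (x div T) + x mod T) \<noteq> A (x mod T)" by (simp add: g_def)
    moreover have "x mod T < T" using T by simp
    ultimately show "x \<in> {x. x div T \<in> (\<Union>c<T. {n. f (T * n + c) \<noteq> A c})}" by blast
  qed
  ultimately have "zero_density {x. f x \<noteq> g x}" by (rule zero_density_subset)
  then have "asym_eq f g" by (simp add: asym_eq_def zero_density_iff)
  moreover have "periodic g" unfolding periodic_def g_def using T(1) by (intro exI[of _ T]) simp
  ultimately show ?thesis by blast
qed

end
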